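(* Let $X \subset \mathbb{R}^d$ be a finite dataset, $k$ a positive integer, and let $\{X_1, \ldots, X_k\}$ be an arbitrary partition (clustering) of $X$; put $OPT = \sum_{i=1}^{k} \Delta(X_i)$. Let $OPT^{\star}$ denote the optimal (unconstrained) $k$-means cost of $X$, and let $C \subset \mathbb{R}^d$ be a set of $k$ centers with $\Phi(C, X) \leq \alpha \cdot OPT^{\star}$ for a constant $\alpha \geq 1$. Let $0 < \varepsilon \leq \frac{1}{2}$, let $t$ be a positive integer, and let $X_{j_1}, \ldots, X_{j_t}$ be an arbitrary set of $t$ of the clusters $X_1, \ldots, X_k$. Let $\mathcal{L}$ be the list returned by the algorithm $t$-GoodCenters$(X, C, \varepsilon, t)$. Then with probability at least $\frac{3}{4}$, $\mathcal{L}$ contains a $t$-center set $\mathcal{C}$ such that \[ \psi(\mathcal{C}, \{X_{j_1}, \ldots, X_{j_t}\}) \leq \left(1 + \frac{\varepsilon}{2}\right) \sum_{i=1}^{t} \Delta(X_{j_i}) + \frac{\varepsilon}{2} \cdot OPT \leq (1+\varepsilon) \cdot OPT. \]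
   Context: For a finite $Y \subset \mathbb{R}^d$ and a finite nonempty $C \subset \mathbb{R}^d$, $\Phi(C, Y) = \sum_{y \in Y} \min_{c \in C} \|y - c\|^2$ (and $\Phi(c, Y) = \Phi(\{c\}, Y)$). $\mu(Y) = \frac{1}{|Y|}\sum_{y \in Y} y$ is the centroid and $\Delta(Y) = \Phi(\mu(Y), Y)$. The optimal $k$-means cost is $OPT^{\star} = \min_{|C| = k} \Phi(C, X)$. For centers $c_1, \ldots, c_t$ and sets $Y_1, \ldots, Y_t$, $\psi(\{c_1,\ldots,c_t\}, \{Y_1, \ldots, Y_t\}) = \min_{\pi} \sum_{i=1}^{t} \Phi(c_{\pi(i)}, Y_i)$, the minimum over permutations $\pi$ of $\{1,\ldots,t\}$. $D^2$-sampling from $X$ w.r.t. $C$ samples $x \in X$ with probability $\Phi(C, \{x\})/\Phi(C, X)$. Algorithm $t$-GoodCenters$(X, C, \varepsilon, t)$: set $\eta = \frac{2^{16}\alpha t}{\varepsilon^4}$ and $\tau = \frac{128}{\varepsilon}$; start with $\mathcal{L} = \emptyset$; repeat $2^t$ times independently: sample a multiset $M$ of $\eta t$ points from $X$ by independent $D^2$-sampling w.r.t. $C$; add $\frac{128 t}{\varepsilon}$ copies of each element of $C$ to $M$; for every choice of pairwise disjoint sub-multisets $S_1, \ldots, S_t$ of $M$ with $|S_i| = \tau$ for all $i$, add the $t$-center set $(\mu(S_1), \ldots, \mu(S_t))$ to $\mathcal{L}$. Return $\mathcal{L}$. *)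

theory Defs
  imports "HOL-Probability.Probability"
begin

definition Phi :: "(real ^ 'd) set \<Rightarrow> (real ^ 'd) set \<Rightarrow> real" where
  "Phi C Y = (\<Sum>y\<in>Y. Min ((\<lambda>c. (norm (y - c))\<^sup>2) ` C))"

definition centroid :: "(real ^ 'd) set \<Rightarrow> real ^ 'd" where
  "centroid Y = (1 / real (card Y)) *\<^sub>R (\<Sum>y\<in>Y. y)"

definition centroid_mset :: "(real ^ 'd) multiset \<Rightarrow> real ^ 'd" where
  "centroid_mset S = (1 / real (size S)) *\<^sub>R (\<Sum>y\<in>#S. y)"

definition Delta :: "(real ^ 'd) set \<Rightarrow> real" where
  "Delta Y = Phi {centroid Y} Y"

text \<open>For finite \<open>X\<close> and \<open>k > 0\<close> the infimum is attained, so it is the minimum.\<close>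

definition OPT_star :: "nat \<Rightarrow> (real ^ 'd) set \<Rightarrow> real" where
  "OPT_star k X = Inf {Phi C X | C. finite C \<and> card C = k}"

definition psi :: "(real ^ 'd) list \<Rightarrow> (real ^ 'd) set list \<Rightarrow> real" where
  "psi cs Ys =
     Min ((\<lambda>\<pi>. \<Sum>i<length Ys. Phi {cs ! \<pi> i} (Ys ! i)) ` {\<pi>. \<pi> permutes {..<length Ys}})"

text \<open>If \<open>Phi C X = 0\<close>, that is \<open>X \<subseteq> C\<close>, the \<open>D\<^sup>2\<close>-weights are undefined (0/0);
  by convention the sampling is then uniform.\<close>

definition D2_pmf :: "(real ^ 'd) set \<Rightarrow> (real ^ 'd) set \<Rightarrow> (real ^ 'd) pmf" where
  "D2_pmf C X = (if Phi C X = 0 then pmf_of_set X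
     else embed_pmf (\<lambda>x. if x \<in> X then Phi C {x} / Phi C X else 0))"

lemma Phi_nonneg: "finite C \<Longrightarrow> C \<noteq> {} \<Longrightarrow> 0 \<le> Phi C Y"
  unfolding Phi_def by (intro sum_nonneg) (simp add: Min_ge_iff)

lemma pmf_D2_pmf:
  assumes "finite X" "finite C" "C \<noteq> {}" "Phi C X \<noteq> 0"
  shows "pmf (D2_pmf C X) x = (if x \<in> X then Phi C {x} / Phi C X else 0)"
proof -
  let ?f = "\<lambda>x. if x \<in> X then Phi C {x} / Phi C X else 0"
  have nn: "0 \<le> ?f x" for x
    using assms by (simp add: Phi_nonneg)
  have "(\<integral>\<^sup>+x. ennreal (?f x) \<partial>count_space UNIV) = (\<Sum>x\<in>X. ennreal (?f x))"
    by (rule nn_integral_count_space') (use assms in auto)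
  also have "\<dots> = ennreal (\<Sum>x\<in>X. ?f x)"
    by (rule sum_ennreal) (rule nn)
  also have "(\<Sum>x\<in>X. ?f x) = (\<Sum>x\<in>X. Phi C {x}) / Phi C X"
    by (simp add: sum_divide_distrib)
  also have "(\<Sum>x\<in>X. Phi C {x}) = Phi C X"
    by (simp add: Phi_def)
  finally have "(\<integral>\<^sup>+x. ennreal (?f x) \<partial>count_space UNIV) = 1"
    using assms by simp
  then show ?thesis
    using assms nn by (simp add: D2_pmf_def pmf_embed_pmf)
qed

text \<open>The real parameters \<open>\<eta>\<close> and \<open>\<tau>\<close> are rounded up to integers. The \<open>128 t / \<epsilon>\<close> copies
  of each center are rounded as \<open>t * \<tau>\<close>.\<close>

definition gc_eta :: "real \<Rightarrow> real \<Rightarrow> nat \<Rightarrow> nat" where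
  "gc_eta \<alpha> \<epsilon> t = nat \<lceil>2 ^ 16 * \<alpha> * real t / \<epsilon> ^ 4\<rceil>"

definition gc_tau :: "real \<Rightarrow> nat" where
  "gc_tau \<epsilon> = nat \<lceil>128 / \<epsilon>\<rceil>"

text \<open>Disjointness of \<open>S\<^sub>1, \<dots>, S\<^sub>t\<close> inside the multiset \<open>M\<close> counts copies: each occurrence in
  \<open>M\<close> is used at most once, i.e. the multiset sum of the \<open>S\<^sub>i\<close> is contained in \<open>M\<close>.\<close>

definition candidate_centers :: "nat \<Rightarrow> nat \<Rightarrow> (real ^ 'd) multiset \<Rightarrow> (real ^ 'd) list set" where
  "candidate_centers t \<tau> M =
     {map centroid_mset Ss | Ss. length Ss = t \<and> (\<forall>S\<in>set Ss. size S = \<tau>) \<and> sum_list Ss \<subseteq># M}"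

definition good_centers_round ::
  "real \<Rightarrow> (real ^ 'd) set \<Rightarrow> (real ^ 'd) set \<Rightarrow> real \<Rightarrow> nat \<Rightarrow> (real ^ 'd) list set pmf" where
  "good_centers_round \<alpha> X C \<epsilon> t =
     map_pmf (\<lambda>xs. candidate_centers t (gc_tau \<epsilon>)
                     (mset xs + repeat_mset (t * gc_tau \<epsilon>) (mset_set C)))
       (replicate_pmf (gc_eta \<alpha> \<epsilon> t * t) (D2_pmf C X))"

definition t_GoodCenters ::
  "real \<Rightarrow> (real ^ 'd) set \<Rightarrow> (real ^ 'd) set \<Rightarrow> real \<Rightarrow> nat \<Rightarrow> (real ^ 'd) list set pmf" where
  "t_GoodCenters \<alpha> X C \<epsilon> t =
     map_pmf (\<lambda>Ls. \<Union> (set Ls)) (replicate_pmf (2 ^ t) (good_centers_round \<alpha> X C \<epsilon> t))"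

end

theory Submission
  imports Defs
begin

text \<open>Fix a cluster \<open>P\<close> and replace every point of a subset \<open>N \<subseteq> P\<close> by its nearest center in \<open>C\<close>, at
  total squared displacement \<open>e\<close>. The mean of \<open>\<tau>\<close> uniform draws from the modified cluster is on
  average close to the centroid of \<open>P\<close>: its excess cost is at most \<open>e + (2 e + 2 \<Delta>(P)) / \<tau>\<close>. Points of
  \<open>N\<close> come for free from the copies of the centers.

  If \<open>\<Phi>(C, P) \<le> \<epsilon> OPT / (4 t)\<close>, take \<open>N = P\<close>: the displacement is paid for by \<open>OPT\<close> and no sampling is
  needed. Otherwise let \<open>N\<close> be the points whose cost is at most \<open>\<epsilon> / 64\<close> times the average cost
  \<open>\<Phi>(C, P) / |P|\<close>. A point of \<open>N\<close> witnesses a center near the cluster, which forces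
  \<open>e \<le> \<epsilon> \<Delta>(P) / 16\<close>; every other point has \<open>D\<^sup>2\<close>-probability at least \<open>q / |P|\<close> with
  \<open>q = \<epsilon>\<^sup>2 / (256 t \<alpha>)\<close>. So \<open>\<eta>\<close> samples simulate \<open>\<tau>\<close> uniform draws except with tiny probability, and
  a cluster succeeds with probability at least \<open>3/4\<close>. Giving each of the \<open>t\<close> clusters its own block of
  \<open>\<eta>\<close> samples, a round succeeds with probability \<open>(3/4)\<^sup>t\<close>, which \<open>2\<^sup>t\<close> rounds amplify to \<open>3/4\<close>.\<close>

subsection \<open>Averages over lists and products of distributions\<close>

text \<open>This is the expectation of \<open>f\<close> over \<open>n\<close> independent uniform
  draws from \<open>P\<close>. The recursion exposes the first draw, so inductions can match draws
  against samples one at a time.\<close>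

primrec avg_lists :: "'a set \<Rightarrow> nat \<Rightarrow> ('a list \<Rightarrow> real) \<Rightarrow> real" where
  "avg_lists P 0 f = f []"
| "avg_lists P (Suc n) f = (\<Sum>x\<in>P. avg_lists P n (\<lambda>l. f (x # l))) / real (card P)"

lemma avg_lists_mono:
  assumes "\<And>l. f l \<le> g l"
  shows "avg_lists P n f \<le> avg_lists P n g"
  using assms
  by (induction n arbitrary: f g) (auto intro!: divide_right_mono sum_mono)

lemma avg_lists_nonneg:
  assumes "\<And>l. 0 \<le> f l"
  shows "0 \<le> avg_lists P n f"
  using assms by (induction n arbitrary: f) (auto intro!: divide_nonneg_nonneg sum_nonneg)

lemma avg_lists_divide: "avg_lists P n (\<lambda>l. f l / c) = avg_lists P n f / c"
  by (induction n arbitrary: f) (simp_all add: sum_divide_distrib[symmetric] field_simps)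

text \<open>First-moment method: some outcome is no worse than the average. It turns the average
  bound into a deterministic choice when a cluster needs no samples.\<close>

lemma avg_lists_ex_le:
  assumes "finite P" "P \<noteq> {}" "avg_lists P n f \<le> K"
  shows "\<exists>l. length l = n \<and> set l \<subseteq> P \<and> f l \<le> K"
  using assms(3)
proof (induction n arbitrary: f)
  case (Suc n)
  have "\<exists>x\<in>P. avg_lists P n (\<lambda>l. f (x # l)) \<le> K"
  proof (rule ccontr)
    assume "\<not> ?thesis"
    then have "(\<Sum>x\<in>P. K) < (\<Sum>x\<in>P. avg_lists P n (\<lambda>l. f (x # l)))"
      using assms by (intro sum_strict_mono) auto
    moreover have "card P > 0" using assms by (simp add: card_gt_0_iff)
    ultimately show False using Suc.prems by (simp add: field_simps)
  qed
  then obtain x where x: "x \<in> P" "avg_lists P n (\<lambda>l. f (x # l)) \<le> K" by blast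
  from Suc.IH[OF x(2)] obtain l where "length l = n" "set l \<subseteq> P" "f (x # l) \<le> K" by blast
  with x(1) show ?case by (intro exI[of _ "x # l"]) auto
qed auto

text \<open>Bias-variance decomposition of a shifted vector; expanding the square, the cross terms
  add up to the inner product of \<open>v\<close> with the mean.\<close>

lemma sum_norm_add_mean:
  fixes h :: "'a \<Rightarrow> 'b::real_inner"
  assumes "finite P" "P \<noteq> {}"
  defines "m \<equiv> (1 / real (card P)) *\<^sub>R (\<Sum>x\<in>P. h x)"
  shows "(\<Sum>x\<in>P. (norm (v + h x))\<^sup>2) / real (card P)
    = (norm (v + m))\<^sup>2 + ((\<Sum>x\<in>P. (norm (h x))\<^sup>2) / real (card P) - (norm m)\<^sup>2)"
proof -
  have n: "real (card P) > 0" using assms by (simp add: card_gt_0_iff)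
  have S: "(\<Sum>x\<in>P. h x) = real (card P) *\<^sub>R m" using n by (simp add: m_def)
  have "(\<Sum>x\<in>P. (norm (v + h x))\<^sup>2) = (\<Sum>x\<in>P. (norm v)\<^sup>2 + 2 * (v \<bullet> h x) + (norm (h x))\<^sup>2)"
    by (intro sum.cong refl) (simp add: power2_norm_eq_inner algebra_simps inner_commute)
  also have "\<dots> = real (card P) * (norm v)\<^sup>2 + 2 * (v \<bullet> (\<Sum>x\<in>P. h x)) + (\<Sum>x\<in>P. (norm (h x))\<^sup>2)"
    by (simp add: sum.distrib sum_distrib_left inner_sum_right)
  finally show ?thesis unfolding S using n
    by (simp add: power2_norm_eq_inner algebra_simps inner_commute add_divide_distrib)
qed

text \<open>Variances of independent draws add up. The shift \<open>v\<close> carries the draws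
  already made, hence it must vary in the induction.\<close>

lemma avg_lists_norm_sum:
  fixes h :: "'a \<Rightarrow> 'b::real_inner"
  assumes "finite P" "P \<noteq> {}"
  defines "m \<equiv> (1 / real (card P)) *\<^sub>R (\<Sum>x\<in>P. h x)"
  shows "avg_lists P n (\<lambda>l. (norm (v + sum_list (map h l)))\<^sup>2)
    = (norm (v + real n *\<^sub>R m))\<^sup>2 + real n * ((\<Sum>x\<in>P. (norm (h x))\<^sup>2) / real (card P) - (norm m)\<^sup>2)"
proof (induction n arbitrary: v)
  case (Suc n)
  have n: "real (card P) > 0" using assms by (simp add: card_gt_0_iff)
  let ?s = "(\<Sum>x\<in>P. (norm (h x))\<^sup>2) / real (card P) - (norm m)\<^sup>2"
  have "avg_lists P (Suc n) (\<lambda>l. (norm (v + sum_list (map h l)))\<^sup>2)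
      = (\<Sum>x\<in>P. avg_lists P n (\<lambda>l. (norm ((v + h x) + sum_list (map h l)))\<^sup>2)) / real (card P)"
    by (simp add: add.assoc)
  also have "\<dots> = (\<Sum>x\<in>P. (norm ((v + real n *\<^sub>R m) + h x))\<^sup>2 + real n * ?s) / real (card P)"
    unfolding Suc.IH by (simp add: add_ac)
  also have "\<dots> = (\<Sum>x\<in>P. (norm ((v + real n *\<^sub>R m) + h x))\<^sup>2) / real (card P) + real n * ?s"
    using n by (simp add: sum.distrib add_divide_distrib)
  also have "\<dots> = (norm ((v + real n *\<^sub>R m) + m))\<^sup>2 + ?s + real n * ?s"
    unfolding m_def by (subst sum_norm_add_mean[OF assms(1,2)]) simp
  finally show ?case by (simp add: algebra_simps add_divide_distrib)
qed simp

section \<open>Independence of samples and of blocks of samples\<close>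

lemma prob_replicate_pmf_Suc:
  assumes "finite X" "set_pmf p \<subseteq> X"
  shows "measure_pmf.prob (replicate_pmf (Suc m) p) A
    = (\<Sum>y\<in>X. pmf p y * measure_pmf.prob (replicate_pmf m p) {ys. y # ys \<in> A})"
proof -
  have eq: "replicate_pmf (Suc m) p = bind_pmf p (\<lambda>y. map_pmf ((#) y) (replicate_pmf m p))"
    by (simp add: map_pmf_def)
  show ?thesis unfolding eq measure_pmf_bind[of p]
    using assms
    by (subst measure_pmf.measure_bind[where N="count_space UNIV"])
       (auto simp: integral_measure_pmf_real[OF assms(1)] subset_iff vimage_def mult.commute
         space_subprob_algebra measure_pmf.subprob_space_axioms)
qed

lemma prob_pair_pmf_Times:
  "measure_pmf.prob (pair_pmf p q) (A \<times> B) = measure_pmf.prob p A * measure_pmf.prob q B"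
proof -
  \<comment> \<open>The product rule applied below asks for countable events, so both are first cut
    down to the supports.\<close>
  have "measure_pmf.prob (pair_pmf p q) (A \<times> B)
      = measure_pmf.prob (pair_pmf p q) ((A \<inter> set_pmf p) \<times> (B \<inter> set_pmf q))"
    by (subst measure_Int_set_pmf[symmetric]) (auto intro!: arg_cong[where f="measure _"])
  also have "\<dots> = measure_pmf.prob p (A \<inter> set_pmf p) * measure_pmf.prob q (B \<inter> set_pmf q)"
    by (intro measure_pmf_prob_product countable_Int2 countable_set_pmf)
  finally show ?thesis by (simp add: measure_Int_set_pmf)
qed

lemma prob_replicate_pmf_add_ge:
  assumes "\<And>xs ys. xs \<in> A \<Longrightarrow> ys \<in> B \<Longrightarrow> xs @ ys \<in> S"
  shows "measure_pmf.prob (replicate_pmf m p) A * measure_pmf.prob (replicate_pmf n p) B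
    \<le> measure_pmf.prob (replicate_pmf (m + n) p) S"
proof -
  have eq: "replicate_pmf (m + n) p
      = map_pmf (\<lambda>(xs, ys). xs @ ys) (pair_pmf (replicate_pmf m p) (replicate_pmf n p))"
    by (simp add: replicate_pmf_distrib pair_pmf_def map_pmf_def bind_assoc_pmf bind_return_pmf)
  have "measure_pmf.prob (replicate_pmf m p) A * measure_pmf.prob (replicate_pmf n p) B
    = measure_pmf.prob (pair_pmf (replicate_pmf m p) (replicate_pmf n p)) (A \<times> B)"
    by (simp add: prob_pair_pmf_Times)
  also have "\<dots> \<le> measure_pmf.prob (replicate_pmf (m + n) p) S"
    unfolding eq using assms by (auto intro!: measure_pmf.finite_measure_mono)
  finally show ?thesis .
qed

lemma prob_replicate_pmf_all:
  "measure_pmf.prob (replicate_pmf n p) {xs. set xs \<subseteq> A} = measure_pmf.prob p A ^ n"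
proof (induction n)
  case (Suc n)
  have eq: "replicate_pmf (Suc n) p = map_pmf (\<lambda>(x, xs). x # xs) (pair_pmf p (replicate_pmf n p))"
    by (simp add: pair_pmf_def map_pmf_def bind_assoc_pmf bind_return_pmf)
  have "measure_pmf.prob (replicate_pmf (Suc n) p) {xs. set xs \<subseteq> A}
    = measure_pmf.prob (pair_pmf p (replicate_pmf n p)) (A \<times> {xs. set xs \<subseteq> A})"
    unfolding eq by (auto intro!: arg_cong[where f="measure _"])
  then show ?case by (simp only: prob_pair_pmf_Times Suc.IH power_Suc)
qed simp

subsection \<open>Simulating uniform draws\<close>

text \<open>Points of \<open>N\<close> are available in unlimited supply; the others must be covered by the samples \<open>ys\<close>.\<close>

definition supplies :: "'a set \<Rightarrow> 'a set \<Rightarrow> nat \<Rightarrow> ('a list \<Rightarrow> bool) \<Rightarrow> 'a list \<Rightarrow> bool" where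
  "supplies P N \<tau> A ys \<longleftrightarrow>
     (\<exists>l. length l = \<tau> \<and> set l \<subseteq> P \<and> A l \<and> filter_mset (\<lambda>x. x \<notin> N) (mset l) \<subseteq># mset ys)"

lemma supplies_Cons: "supplies P N \<tau> A ys \<Longrightarrow> supplies P N \<tau> A (y # ys)"
  unfolding supplies_def by (metis mset.simps(2) mset_subset_eq_add_right add_mset_add_single
      subset_mset.order_trans union_commute)

lemma supplies_free:
  assumes "x \<in> P" "x \<in> N" "supplies P N \<tau> (\<lambda>l. A (x # l)) ys"
  shows "supplies P N (Suc \<tau>) A ys"
proof -
  from assms(3) obtain l where "length l = \<tau>" "set l \<subseteq> P" "A (x # l)"
    "filter_mset (\<lambda>x. x \<notin> N) (mset l) \<subseteq># mset ys" unfolding supplies_def by blast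
  then show ?thesis unfolding supplies_def using assms(1,2)
    by (intro exI[of _ "x # l"]) auto
qed

lemma supplies_sampled:
  assumes "y \<in> P" "y \<notin> N" "supplies P N \<tau> (\<lambda>l. A (y # l)) ys"
  shows "supplies P N (Suc \<tau>) A (y # ys)"
proof -
  from assms(3) obtain l where "length l = \<tau>" "set l \<subseteq> P" "A (y # l)"
    "filter_mset (\<lambda>x. x \<notin> N) (mset l) \<subseteq># mset ys" unfolding supplies_def by blast
  then show ?thesis unfolding supplies_def using assms(1,2)
    by (intro exI[of _ "y # l"]) auto
qed

text \<open>Splits one sample: the mass \<open>q / |P|\<close> of each \<open>y \<in> P - N\<close> pays for drawing \<open>y\<close>. The remaining
  mass is \<open>(1 - q) + q |P \<inter> N| / |P|\<close> and may be attributed to any draw from \<open>N\<close> or to no draw.\<close>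

lemma weighted_sum_le_mixture:
  fixes p g w :: "'a \<Rightarrow> real"
  assumes X: "finite X" "P \<subseteq> X" "P \<noteq> {}"
    and q: "0 \<le> q" "q \<le> 1"
    and p: "\<And>y. y \<in> X \<Longrightarrow> 0 \<le> p y" "sum p X = 1"
    and pq: "\<And>y. y \<in> P - N \<Longrightarrow> q / real (card P) \<le> p y"
    and g0: "\<And>y. y \<in> X \<Longrightarrow> g y \<le> w0"
    and gN: "\<And>x y. x \<in> P \<inter> N \<Longrightarrow> y \<in> X \<Longrightarrow> g y \<le> w x"
    and gF: "\<And>y. y \<in> P - N \<Longrightarrow> g y \<le> w y"
  shows "(\<Sum>y\<in>X. p y * g y) \<le> (1 - q) * w0 + q * (sum w P / real (card P))"
proof -
  define n where "n = real (card P)"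
  have fP: "finite P" using X finite_subset by blast
  have n: "n > 0" unfolding n_def using X fP by (simp add: card_gt_0_iff)
  have nsplit: "n = real (card (P - N)) + real (card (P \<inter> N))"
    unfolding n_def using card_Un_disjoint[of "P - N" "P \<inter> N"] fP
    by (auto simp: Un_Diff_Int simp flip: of_nat_add)
  define r where "r y = p y - (if y \<in> P - N then q / n else 0)" for y
  have r0: "r y \<ge> 0" if "y \<in> X" for y
    using p(1)[OF that] pq[of y] unfolding r_def n_def by auto
  have XF: "X \<inter> (P - N) = P - N" using X by auto
  have onF: "(\<Sum>y\<in>X. (if y \<in> P - N then q / n else 0) * f y) = (\<Sum>y\<in>P - N. q / n * f y)" for f
  proof -
    have "(\<Sum>y\<in>X. (if y \<in> P - N then q / n else 0) * f y) = (\<Sum>y\<in>X. if y \<in> P - N then q / n * f y else 0)"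
      by (intro sum.cong) auto
    also have "\<dots> = (\<Sum>y\<in>X \<inter> (P - N). q / n * f y)"
      by (rule sum.inter_restrict[OF X(1), symmetric])
    finally show ?thesis unfolding XF .
  qed
  have "sum r X = 1 - (\<Sum>y\<in>X. (if y \<in> P - N then q / n else 0) * 1)"
    unfolding r_def sum_subtractf p(2) by simp
  also have "\<dots> = 1 - real (card (P - N)) * (q / n)" unfolding onF by simp
  also have "\<dots> = (1 - q) + q * real (card (P \<inter> N)) / n"
    using n nsplit by (simp add: field_simps)
  finally have sr: "sum r X = (1 - q) + q * real (card (P \<inter> N)) / n" .
  \<comment> \<open>All residual mass is charged the largest value \<open>V\<close> of
    \<open>g\<close>. As \<open>V\<close> is attained, it lies below \<open>w0\<close> and below
    every \<open>w x\<close> with \<open>x \<in> P \<inter> N\<close>, so the mass can be divided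
    among these by amount alone, no matter which samples carry it.\<close>
  define V where "V = Max (g ` X)"
  have "V \<in> g ` X" unfolding V_def using X by (intro Max_in) auto
  then obtain y0 where y0: "y0 \<in> X" "V = g y0" by blast
  have gV: "g y \<le> V" if "y \<in> X" for y unfolding V_def using X that by simp
  have "real (card (P \<inter> N)) * V \<le> sum w (P \<inter> N)"
    using sum_mono[of "P \<inter> N" "\<lambda>_. V" w] gN[OF _ y0(1)] y0(2) by simp
  from mult_left_mono[OF this, of "q / n"]
  have a1: "q * real (card (P \<inter> N)) / n * V \<le> q / n * sum w (P \<inter> N)" using q n by (simp add: field_simps)
  have a2: "(1 - q) * V \<le> (1 - q) * w0" using q g0[OF y0(1)] y0(2) by (intro mult_left_mono) auto
  have "(\<Sum>y\<in>X. p y * g y) = (\<Sum>y\<in>X. r y * g y + (if y \<in> P - N then q / n else 0) * g y)"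
    by (intro sum.cong) (auto simp: r_def algebra_simps)
  also have "\<dots> = (\<Sum>y\<in>X. r y * g y) + (\<Sum>y\<in>P - N. q / n * g y)"
    by (simp only: sum.distrib onF)
  also have "\<dots> \<le> (\<Sum>y\<in>X. r y * V) + (\<Sum>y\<in>P - N. q / n * w y)"
    using r0 gV gF q n by (intro add_mono sum_mono mult_left_mono) auto
  also have "(\<Sum>y\<in>X. r y * V) = (1 - q) * V + q * real (card (P \<inter> N)) / n * V"
    unfolding sum_distrib_right[symmetric] sr by (simp add: algebra_simps)
  also have "\<dots> \<le> (1 - q) * w0 + q / n * sum w (P \<inter> N)" using a1 a2 by simp
  also have "(1 - q) * w0 + q / n * sum w (P \<inter> N) + (\<Sum>y\<in>P - N. q / n * w y)
    = (1 - q) * w0 + q / n * (sum w (P \<inter> N) + sum w (P - N))"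
    by (simp add: sum_distrib_left algebra_simps)
  also have "sum w (P \<inter> N) + sum w (P - N) = sum w P"
    using sum.Int_Diff[OF fP, of w N] by simp
  finally show ?thesis by (simp add: n_def)
qed

text \<open>The error term \<open>2\<^sup>\<tau> (1 - q / 2)\<^sup>m\<close> is the exponential Markov bound on \<open>P(Bin(m, q) < \<tau>)\<close>; it
  satisfies the recursion of that probability exactly, which lets the induction close.\<close>

lemma prob_not_supplies_le:
  fixes p :: "'a pmf"
  assumes X: "finite X" "set_pmf p \<subseteq> X" "P \<subseteq> X" "P \<noteq> {}"
    and q: "0 \<le> q" "q \<le> 1"
    and pq: "\<And>y. y \<in> P - N \<Longrightarrow> q / real (card P) \<le> pmf p y"
  shows "measure_pmf.prob (replicate_pmf m p) {ys. \<not> supplies P N \<tau> A ys}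
    \<le> avg_lists P \<tau> (\<lambda>l. if A l then 0 else 1) + 2 ^ \<tau> * (1 - q / 2) ^ m"
proof (induction m arbitrary: \<tau> A)
  case 0
  show ?case
  proof (cases \<tau>)
    case 0
    then show ?thesis by (auto simp: supplies_def measure_return indicator_def)
  next
    case (Suc t)
    \<comment> \<open>With no samples and draws still due, the error term is
      \<open>2 ^ \<tau> \<ge> 1\<close> and the bound is trivial.\<close>
    have "0 \<le> avg_lists P \<tau> (\<lambda>l. if A l then 0 else 1)"
      by (rule avg_lists_nonneg) simp
    moreover have "(1::real) \<le> 2 ^ \<tau>" by simp
    moreover have "measure_pmf.prob (replicate_pmf 0 p) {ys. \<not> supplies P N \<tau> A ys} \<le> 1" by simp
    ultimately show ?thesis by (smt (verit) mult_cancel_left1 power_0)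
  qed
next
  case (Suc m)
  show ?case
  proof (cases \<tau>)
    case 0
    show ?thesis
    proof (cases "A []")
      case True
      then have "supplies P N \<tau> A ys" for ys using 0 by (auto simp: supplies_def)
      then show ?thesis using 0 True q by simp
    next
      case False
      have "measure_pmf.prob (replicate_pmf (Suc m) p) {ys. \<not> supplies P N \<tau> A ys} \<le> 1" by simp
      also have "1 \<le> avg_lists P \<tau> (\<lambda>l. if A l then 0 else 1) + 2 ^ \<tau> * (1 - q / 2) ^ Suc m"
        using 0 False q by simp
      finally show ?thesis .
    qed
  next
    case (Suc s)
    \<comment> \<open>\<open>W\<close> is the failure probability with one sample fewer,
      \<open>g y\<close> the same after \<open>y\<close> was sampled first, and \<open>w x\<close>
      the one after the first draw is settled as \<open>x\<close>.\<close>
    define W where "W \<tau> A = measure_pmf.prob (replicate_pmf m p) {ys. \<not> supplies P N \<tau> A ys}" for \<tau> A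
    define g where "g y = measure_pmf.prob (replicate_pmf m p) {ys. \<not> supplies P N \<tau> A (y # ys)}" for y
    define w where "w x = W s (\<lambda>l. A (x # l))" for x
    define b where "b = 2 ^ s * (1 - q / 2) ^ m"
    define V where "V x = avg_lists P s (\<lambda>l. if A (x # l) then 0 else 1)" for x
    have n: "real (card P) > 0" using X finite_subset[OF X(3,1)] by (simp add: card_gt_0_iff)
    have "measure_pmf.prob (replicate_pmf (Suc m) p) {ys. \<not> supplies P N \<tau> A ys}
        = (\<Sum>y\<in>X. pmf p y * g y)"
      unfolding prob_replicate_pmf_Suc[OF X(1,2)] g_def by simp
    also have "\<dots> \<le> (1 - q) * W \<tau> A + q * (sum w P / real (card P))"
    proof (rule weighted_sum_le_mixture[OF X(1,3,4) q _ _ pq])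
      show "sum (pmf p) X = 1" using X by (simp add: sum_pmf_eq_1)
      \<comment> \<open>The three ways to use a first sample: ignore it; ignore it and take a free
        point of \<open>N\<close> as the first draw; take the sample itself as the first
        draw.\<close>
      show "g y \<le> W \<tau> A" for y unfolding g_def W_def
        by (intro measure_pmf.finite_measure_mono) (auto dest: supplies_Cons)
      show "g y \<le> w x" if "x \<in> P \<inter> N" for x y unfolding g_def w_def W_def Suc
        using that by (intro measure_pmf.finite_measure_mono Collect_mono impI)
          (auto intro: supplies_Cons supplies_free)
      show "g y \<le> w y" if "y \<in> P - N" for y unfolding g_def w_def W_def Suc
        using that by (intro measure_pmf.finite_measure_mono Collect_mono impI)
          (auto intro: supplies_sampled)
    qed auto
    also have "\<dots> \<le> (1 - q) * (avg_lists P \<tau> (\<lambda>l. if A l then 0 else 1) + 2 * b)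
        + q * (sum (\<lambda>x. V x + b) P / real (card P))"
    proof (intro add_mono mult_left_mono divide_right_mono sum_mono)
      show "W \<tau> A \<le> avg_lists P \<tau> (\<lambda>l. if A l then 0 else 1) + 2 * b"
        using Suc.IH[of \<tau> A] unfolding W_def b_def Suc by simp
      show "w x \<le> V x + b" for x
        using Suc.IH[of s "\<lambda>l. A (x # l)"] unfolding W_def b_def w_def V_def by simp
    qed (use q in auto)
    also have "sum (\<lambda>x. V x + b) P / real (card P) = avg_lists P \<tau> (\<lambda>l. if A l then 0 else 1) + b"
      unfolding Suc using n by (simp add: V_def sum.distrib add_divide_distrib)
    \<comment> \<open>The averages recombine with weights \<open>1 - q\<close> and \<open>q\<close>,
      and \<open>(1 - q) * 2 * b + q * b = 2 * b * (1 - q / 2)\<close>.\<close>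
    also have "(1 - q) * (avg_lists P \<tau> (\<lambda>l. if A l then 0 else 1) + 2 * b)
        + q * (avg_lists P \<tau> (\<lambda>l. if A l then 0 else 1) + b)
        = avg_lists P \<tau> (\<lambda>l. if A l then 0 else 1) + 2 ^ \<tau> * (1 - q / 2) ^ Suc m"
      unfolding b_def Suc power_Suc by (simp add: algebra_simps del: avg_lists.simps)
    finally show ?thesis .
  qed
qed

subsection \<open>Perturbed centroids\<close>

lemma norm_add_sq_le: "(norm (a + b))\<^sup>2 \<le> 2 * (norm a)\<^sup>2 + 2 * (norm b)\<^sup>2"
  for a b :: "'a::real_inner"
proof -
  have "(norm (a + b))\<^sup>2 + (norm (a - b))\<^sup>2 = 2 * (norm a)\<^sup>2 + 2 * (norm b)\<^sup>2"
    by (simp add: power2_norm_eq_inner algebra_simps inner_commute)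
  then show ?thesis using zero_le_power2[of "norm (a - b)"] by linarith
qed

lemma Phi_singleton: "Phi {c} Y = (\<Sum>y\<in>Y. (norm (y - c))\<^sup>2)"
  by (simp add: Phi_def)

lemma Delta_nonneg: "0 \<le> Delta Y"
  unfolding Delta_def by (rule Phi_nonneg) auto

lemma sum_diff_centroid: "finite P \<Longrightarrow> (\<Sum>x\<in>P. x - centroid P) = 0"
  by (cases "P = {}") (simp_all add: sum_subtractf centroid_def sum_constant_scaleR del: sum_constant)

text \<open>The decomposition of \<open>sum_norm_add_mean\<close> for the deviations from the
  centroid, whose mean is zero.\<close>

lemma Phi_singleton_eq:
  assumes "finite P"
  shows "Phi {c} P = Delta P + real (card P) * (norm (c - centroid P))\<^sup>2"
proof (cases "P = {}")
  case False
  have "real (card P) > 0" using assms False by (simp add: card_gt_0_iff)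
  then show ?thesis
    using sum_norm_add_mean[OF assms False, of "centroid P - c" "\<lambda>x. x - centroid P"]
    by (simp add: sum_diff_centroid[OF assms] Delta_def Phi_singleton norm_minus_commute field_simps)
qed (simp add: Phi_def Delta_def)

text \<open>The averaged quantity is the excess cost in \<open>Phi_centroid_mset_map\<close>. Its
  bias part is the mean displacement, which contributes at most \<open>e\<close>; its variance part
  is at most the second moment of the modified points about the centroid of \<open>P\<close>,
  divided by \<open>\<tau>\<close>.\<close>

lemma avg_lists_perturbed_centroid_le:
  fixes g :: "real ^ 'd \<Rightarrow> real ^ 'd"
  assumes "finite P" "P \<noteq> {}" "\<tau> > 0"
  defines "e \<equiv> \<Sum>x\<in>P. (norm (g x - x))\<^sup>2"
  shows "avg_lists P \<tau> (\<lambda>l. real (card P) / (real \<tau>)\<^sup>2 * (norm (\<Sum>x\<leftarrow>l. g x - centroid P))\<^sup>2)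
    \<le> e + (2 * e + 2 * Delta P) / real \<tau>"
proof -
  define n where "n = real (card P)"
  have n: "n > 0" unfolding n_def using assms by (simp add: card_gt_0_iff)
  define h where "h x = g x - centroid P" for x
  define m where "m = (1 / n) *\<^sub>R (\<Sum>x\<in>P. h x)"
  define H where "H = (\<Sum>x\<in>P. (norm (h x))\<^sup>2)"
  have "(\<Sum>x\<in>P. h x) = (\<Sum>x\<in>P. g x - x) + (\<Sum>x\<in>P. x - centroid P)"
    unfolding h_def by (simp add: sum_subtractf)
  then have mg: "m = (1 / real (card P)) *\<^sub>R (\<Sum>x\<in>P. g x - x)"
    unfolding m_def n_def by (simp add: sum_diff_centroid[OF assms(1)])
  \<comment> \<open>The variance of the displacements about their mean \<open>m\<close> is
    nonnegative, which is Jensen's inequality for \<open>m\<close>.\<close>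
  have "0 \<le> (\<Sum>x\<in>P. (norm (- m + (g x - x)))\<^sup>2) / real (card P)"
    by (intro divide_nonneg_nonneg sum_nonneg) auto
  also have "\<dots> = e / n - (norm m)\<^sup>2"
    unfolding mg by (subst sum_norm_add_mean[OF assms(1,2)]) (simp add: e_def n_def)
  finally have me: "n * (norm m)\<^sup>2 \<le> e" using n by (simp add: field_simps)
  have "(norm (h x))\<^sup>2 \<le> 2 * (norm (g x - x))\<^sup>2 + 2 * (norm (x - centroid P))\<^sup>2" for x
    using norm_add_sq_le[of "g x - x" "x - centroid P"] by (simp add: h_def)
  then have "H \<le> (\<Sum>x\<in>P. 2 * (norm (g x - x))\<^sup>2 + 2 * (norm (x - centroid P))\<^sup>2)"
    unfolding H_def by (intro sum_mono)
  also have "\<dots> = 2 * e + 2 * Delta P"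
    by (simp add: sum.distrib sum_distrib_left e_def Delta_def Phi_singleton)
  finally have He: "H \<le> 2 * e + 2 * Delta P" .
  have "avg_lists P \<tau> (\<lambda>l. n / (real \<tau>)\<^sup>2 * (norm (\<Sum>x\<leftarrow>l. h x))\<^sup>2)
      = avg_lists P \<tau> (\<lambda>l. (norm (0 + (\<Sum>x\<leftarrow>l. h x)))\<^sup>2) / ((real \<tau>)\<^sup>2 / n)"
    unfolding avg_lists_divide[symmetric] using n by (simp add: field_simps)
  also have "\<dots> = ((norm (0 + real \<tau> *\<^sub>R m))\<^sup>2 + real \<tau> * (H / n - (norm m)\<^sup>2)) / ((real \<tau>)\<^sup>2 / n)"
    unfolding m_def H_def n_def by (subst avg_lists_norm_sum[OF assms(1,2)]) (rule refl)
  also have "\<dots> = n * (norm m)\<^sup>2 + (H - n * (norm m)\<^sup>2) / real \<tau>"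
    using n assms(3) by (simp add: field_simps power2_eq_square)
  also have "\<dots> \<le> e + (2 * e + 2 * Delta P) / real \<tau>"
  proof (intro add_mono divide_right_mono me)
    have "0 \<le> n * (norm m)\<^sup>2" using n by simp
    then show "H - n * (norm m)\<^sup>2 \<le> 2 * e + 2 * Delta P" using He by linarith
  qed auto
  finally show ?thesis unfolding n_def h_def .
qed

lemma centroid_mset_map_diff:
  assumes "length l = \<tau>" "\<tau> > 0"
  shows "centroid_mset (mset (map g l)) - a = (1 / real \<tau>) *\<^sub>R (\<Sum>x\<leftarrow>l. g x - a)"
proof -
  have "(\<Sum>x\<leftarrow>l. g x - a) = (\<Sum>x\<leftarrow>l. g x) - real (length l) *\<^sub>R a"
    by (induction l) (simp_all add: algebra_simps)
  then show ?thesis using assms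
    by (simp add: centroid_mset_def sum_mset_sum_list scaleR_diff_right flip: mset_map)
qed

lemma Phi_centroid_mset_map:
  assumes "finite P" "length l = \<tau>" "\<tau> > 0"
  shows "Phi {centroid_mset (mset (map g l))} P
    = Delta P + real (card P) / (real \<tau>)\<^sup>2 * (norm (\<Sum>x\<leftarrow>l. g x - centroid P))\<^sup>2"
  unfolding Phi_singleton_eq[OF assms(1)] centroid_mset_map_diff[OF assms(2,3)]
  using assms(3) by (simp add: power_mult_distrib power_divide)

text \<open>Even if all draws snap to the same center, only \<open>\<tau>\<close> copies of it are
  used up, because \<open>l\<close> has length \<open>\<tau>\<close>.\<close>

lemma mset_map_snapped_subseteq:
  assumes "finite C" "length l = \<tau>" "filter_mset (\<lambda>x. x \<notin> N) (mset l) \<subseteq># mset ys"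
    and "\<And>x. x \<in> set l \<inter> N \<Longrightarrow> g x \<in> C" "\<And>x. x \<notin> N \<Longrightarrow> g x = x"
  shows "mset (map g l) \<subseteq># mset ys + repeat_mset \<tau> (mset_set C)"
proof -
  let ?I = "image_mset g (filter_mset (\<lambda>x. x \<in> N) (mset l))"
  have "mset (map g l) = image_mset g (mset l)" by simp
  also have "\<dots> = image_mset g (filter_mset (\<lambda>x. x \<in> N) (mset l) + filter_mset (\<lambda>x. x \<notin> N) (mset l))"
    by (rule arg_cong[OF multiset_partition])
  also have "\<dots> = ?I + image_mset g (filter_mset (\<lambda>x. x \<notin> N) (mset l))"
    by (rule image_mset_union)
  also have "image_mset g (filter_mset (\<lambda>x. x \<notin> N) (mset l)) = filter_mset (\<lambda>x. x \<notin> N) (mset l)"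
    using assms(5) by (intro image_mset_cong[where g="\<lambda>x. x", simplified]) auto
  finally have eq: "mset (map g l) = ?I + filter_mset (\<lambda>x. x \<notin> N) (mset l)" .
  have "?I \<subseteq># repeat_mset \<tau> (mset_set C)"
  proof (rule mset_subset_eqI)
    fix a
    show "count ?I a \<le> count (repeat_mset \<tau> (mset_set C)) a"
    proof (cases "a \<in># ?I")
      case True
      then have "a \<in> C" using assms(4) by auto
      have "count ?I a \<le> size ?I" by (rule count_le_size)
      also have "\<dots> \<le> \<tau>" using size_filter_mset_lesseq[of _ "mset l"] assms(2) by simp
      finally show ?thesis using \<open>a \<in> C\<close> assms(1) by simp
    next
      case False
      then have "count ?I a = 0" by (simp only: not_in_iff)
      then show ?thesis by simp
    qed
  qed
  with assms(3) show ?thesis unfolding eq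
    by (metis subset_mset.add_mono union_commute)
qed

section \<open>Nearest centers and sub-multisets with good centroids\<close>

definition nearest :: "(real ^ 'd) set \<Rightarrow> real ^ 'd \<Rightarrow> real ^ 'd" where
  "nearest C x = arg_min_on (\<lambda>c. norm (x - c)) C"

lemma
  assumes "finite C" "C \<noteq> {}"
  shows nearest_in: "nearest C x \<in> C"
    and Min_nearest: "Min ((\<lambda>c. (norm (x - c))\<^sup>2) ` C) = (norm (x - nearest C x))\<^sup>2"
proof -
  show in_C: "nearest C x \<in> C" unfolding nearest_def by (rule arg_min_if_finite(1)[OF assms])
  show "Min ((\<lambda>c. (norm (x - c))\<^sup>2) ` C) = (norm (x - nearest C x))\<^sup>2"
  proof (rule Min_eqI)
    fix y assume "y \<in> (\<lambda>c. (norm (x - c))\<^sup>2) ` C"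
    then show "(norm (x - nearest C x))\<^sup>2 \<le> y"
      using arg_min_least[OF assms, of _ "\<lambda>c. norm (x - c)"] by (auto simp: nearest_def intro!: power_mono)
  qed (use assms in_C in auto)
qed

lemma Phi_eq_nearest:
  assumes "finite C" "C \<noteq> {}"
  shows "Phi C Y = (\<Sum>y\<in>Y. (norm (y - nearest C y))\<^sup>2)"
  unfolding Phi_def by (simp add: Min_nearest[OF assms])

lemma Phi_le_Phi_singleton:
  assumes "finite C" "c \<in> C"
  shows "Phi C Y \<le> Phi {c} Y"
  unfolding Phi_def using assms by (intro sum_mono) auto

text \<open>Only \<open>\<tau>\<close> copies of each center are granted: this is one cluster's
  share of the \<open>t * \<tau>\<close> copies, so that the choices for different clusters can be
  added up without overlap.\<close>

definition good_sample :: "nat \<Rightarrow> (real ^ 'd) set \<Rightarrow> (real ^ 'd) set \<Rightarrow> real \<Rightarrow> (real ^ 'd) multiset \<Rightarrow> bool" where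
  "good_sample \<tau> C P r M \<longleftrightarrow> (\<exists>S. size S = \<tau> \<and> S \<subseteq># M + repeat_mset \<tau> (mset_set C) \<and>
     Phi {centroid_mset S} P \<le> Delta P + r)"

lemma good_sample_low_cost:
  assumes "finite P" "finite C" "C \<noteq> {}" "\<tau> > 0" "0 \<le> r"
    and "P \<noteq> {} \<Longrightarrow> Phi C P + (2 * Phi C P + 2 * Delta P) / real \<tau> \<le> r"
  shows "good_sample \<tau> C P r M"
proof (cases "P = {}")
  \<comment> \<open>For an empty cluster both costs are empty sums, and any center repeated
    \<open>\<tau>\<close> times will do.\<close>
  case True
  obtain c where c: "c \<in> C" using assms by blast
  have "mset (map (\<lambda>_. c) (replicate \<tau> c)) \<subseteq># mset [] + repeat_mset \<tau> (mset_set C)"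
    by (rule mset_map_snapped_subseteq[where N = UNIV]) (use assms c in auto)
  then have "mset (map (\<lambda>_. c) (replicate \<tau> c)) \<subseteq># M + repeat_mset \<tau> (mset_set C)"
    using subset_mset.add_increasing by fastforce
  then show ?thesis unfolding good_sample_def using True assms
    by (intro exI[of _ "mset (map (\<lambda>_. c) (replicate \<tau> c))"]) (auto simp: Phi_def Delta_def)
next
  case False
  have "(\<Sum>x\<in>P. (norm (nearest C x - x))\<^sup>2) = Phi C P"
    by (simp add: Phi_eq_nearest[OF assms(2,3)] norm_minus_commute)
  from avg_lists_perturbed_centroid_le[OF assms(1) False assms(4), of "nearest C", unfolded this]
  have "avg_lists P \<tau> (\<lambda>l. real (card P) / (real \<tau>)\<^sup>2 * (norm (\<Sum>x\<leftarrow>l. nearest C x - centroid P))\<^sup>2) \<le> r"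
    using assms(6)[OF False] by linarith
  from avg_lists_ex_le[OF assms(1) False this] obtain l where l: "length l = \<tau>"
    "real (card P) / (real \<tau>)\<^sup>2 * (norm (\<Sum>x\<leftarrow>l. nearest C x - centroid P))\<^sup>2 \<le> r" by blast
  \<comment> \<open>With \<open>N = UNIV\<close> every draw snaps, so the copies of the centers
    suffice without any sample.\<close>
  have "mset (map (nearest C) l) \<subseteq># mset [] + repeat_mset \<tau> (mset_set C)"
    by (rule mset_map_snapped_subseteq[where N = UNIV]) (use assms l nearest_in in auto)
  then have "mset (map (nearest C) l) \<subseteq># M + repeat_mset \<tau> (mset_set C)"
    using subset_mset.add_increasing by fastforce
  then show ?thesis unfolding good_sample_def using l
    by (intro exI[of _ "mset (map (nearest C) l)"])
      (simp add: Phi_centroid_mset_map[OF assms(1) l(1) assms(4)] del: mset_map)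
qed

text \<open>Failure has two sources: the simulated draws have excess cost above \<open>r\<close>,
  which Markov's inequality bounds, or the samples do not suffice for the simulation.\<close>

lemma prob_good_sample_ge:
  fixes P C N :: "(real ^ 'd) set"
  assumes X: "finite X" "set_pmf p \<subseteq> X" "P \<subseteq> X" "P \<noteq> {}"
    and C: "finite C" "C \<noteq> {}"
    and q: "0 \<le> q" "q \<le> 1"
    and pq: "\<And>y. y \<in> P - N \<Longrightarrow> q / real (card P) \<le> pmf p y"
    and "\<tau> > 0" "r > 0" and NP: "N \<subseteq> P"
  defines "e \<equiv> \<Sum>x\<in>N. (norm (x - nearest C x))\<^sup>2"
  shows "measure_pmf.prob (replicate_pmf m p) {ys. good_sample \<tau> C P r (mset ys)}
    \<ge> 1 - (e + (2 * e + 2 * Delta P) / real \<tau>) / r - 2 ^ \<tau> * (1 - q / 2) ^ m"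
proof -
  have fP: "finite P" using X finite_subset by blast
  define g where "g x = (if x \<in> N then nearest C x else x)" for x
  define f where "f l = real (card P) / (real \<tau>)\<^sup>2 * (norm (\<Sum>x\<leftarrow>l. g x - centroid P))\<^sup>2" for l
  have f0: "f l \<ge> 0" for l unfolding f_def by simp
  have "(\<Sum>x\<in>P. (norm (g x - x))\<^sup>2) = (\<Sum>x\<in>P. if x \<in> N then (norm (x - nearest C x))\<^sup>2 else 0)"
    by (intro sum.cong) (auto simp: g_def norm_minus_commute)
  also have "\<dots> = (\<Sum>x\<in>P \<inter> N. (norm (x - nearest C x))\<^sup>2)" by (rule sum.inter_restrict[OF fP, symmetric])
  finally have eg: "(\<Sum>x\<in>P. (norm (g x - x))\<^sup>2) = e" using NP by (simp add: e_def Int_absorb1)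
  have "avg_lists P \<tau> (\<lambda>l. if f l \<le> r then 0 else 1) \<le> avg_lists P \<tau> (\<lambda>l. f l / r)"
    using \<open>r > 0\<close> f0 by (intro avg_lists_mono) (auto simp: field_simps)
  also have "\<dots> \<le> (e + (2 * e + 2 * Delta P) / real \<tau>) / r"
    unfolding avg_lists_divide f_def
    using avg_lists_perturbed_centroid_le[OF fP X(4) \<open>\<tau> > 0\<close>, of g, unfolded eg] \<open>r > 0\<close>
    by (intro divide_right_mono) auto
  finally have avg: "avg_lists P \<tau> (\<lambda>l. if f l \<le> r then 0 else 1) \<le> \<dots>" .
  have sup: "good_sample \<tau> C P r (mset ys)" if "supplies P N \<tau> (\<lambda>l. f l \<le> r) ys" for ys
  proof -
    from that obtain l where l: "length l = \<tau>" "f l \<le> r"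
      "filter_mset (\<lambda>x. x \<notin> N) (mset l) \<subseteq># mset ys" unfolding supplies_def by blast
    have "mset (map g l) \<subseteq># mset ys + repeat_mset \<tau> (mset_set C)"
      by (rule mset_map_snapped_subseteq[OF C(1) l(1,3)]) (use nearest_in[OF C] in \<open>auto simp: g_def\<close>)
    then show ?thesis unfolding good_sample_def using l
      by (intro exI[of _ "mset (map g l)"])
        (simp add: Phi_centroid_mset_map[OF fP l(1) \<open>\<tau> > 0\<close>] f_def del: mset_map)
  qed
  have "1 - measure_pmf.prob (replicate_pmf m p) {ys. \<not> supplies P N \<tau> (\<lambda>l. f l \<le> r) ys}
      = measure_pmf.prob (replicate_pmf m p) {ys. supplies P N \<tau> (\<lambda>l. f l \<le> r) ys}"
    by (subst measure_pmf.prob_compl[symmetric]) (auto intro!: arg_cong[where f="measure _"])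
  also have "\<dots> \<le> measure_pmf.prob (replicate_pmf m p) {ys. good_sample \<tau> C P r (mset ys)}"
    using sup by (intro measure_pmf.finite_measure_mono) auto
  finally show ?thesis
    using prob_not_supplies_le[OF X q pq, of N m \<tau> "\<lambda>l. f l \<le> r"] avg by linarith
qed

subsection \<open>One cluster\<close>

text \<open>Serving \<open>P\<close> by the center nearest to a point \<open>x\<close> of
  \<open>N\<close> costs at least \<open>\<phi>\<close>; this bounds \<open>\<phi>\<close> by
  \<open>D\<close>, a small multiple of \<open>\<phi>\<close> and the squared distance from
  \<open>x\<close> to the centroid. Over \<open>N\<close> those distances total at most
  \<open>D\<close>, so a large \<open>N\<close> forces a small \<open>\<phi>\<close>, while a small
  \<open>N\<close> is cheap to move.\<close>

lemma snapping_cost_le: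
  assumes "finite P" "P \<noteq> {}" "finite C" "C \<noteq> {}" "0 \<le> \<zeta>" "\<zeta> \<le> 1 / 8"
  defines "N \<equiv> {x \<in> P. (norm (x - nearest C x))\<^sup>2 \<le> \<zeta> * Phi C P / real (card P)}"
  shows "(\<Sum>x\<in>N. (norm (x - nearest C x))\<^sup>2) \<le> 4 * \<zeta> * Delta P"
proof -
  define n where "n = real (card P)"
  define k where "k = real (card N)"
  define \<phi> where "\<phi> = Phi C P"
  define D where "D = Delta P"
  define \<mu> where "\<mu> = centroid P"
  have n: "n > 0" unfolding n_def using assms by (simp add: card_gt_0_iff)
  have NP: "N \<subseteq> P" and kn: "k \<le> n" "k \<ge> 0"
    unfolding N_def k_def n_def by (auto intro!: card_mono assms)
  have \<phi>: "\<phi> \<ge> 0" and D: "D \<ge> 0"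
    unfolding \<phi>_def D_def using assms by (simp_all add: Phi_nonneg Delta_nonneg)
  have "(1 - 2 * \<zeta>) * \<phi> \<le> D + 2 * n * (norm (x - \<mu>))\<^sup>2" if "x \<in> N" for x
  proof -
    let ?c = "nearest C x"
    have "\<phi> \<le> D + n * (norm (?c - \<mu>))\<^sup>2"
      unfolding \<phi>_def D_def n_def \<mu>_def Phi_singleton_eq[OF assms(1), symmetric]
      using assms nearest_in by (intro Phi_le_Phi_singleton) auto
    also have "\<dots> \<le> D + n * (2 * (norm (?c - x))\<^sup>2 + 2 * (norm (x - \<mu>))\<^sup>2)"
      using norm_add_sq_le[of "?c - x" "x - \<mu>"] n by (intro add_mono mult_left_mono) auto
    also have "(norm (?c - x))\<^sup>2 \<le> \<zeta> * \<phi> / n"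
      using that by (simp add: N_def norm_minus_commute n_def \<phi>_def)
    also have "n * (2 * (\<zeta> * \<phi> / n) + 2 * (norm (x - \<mu>))\<^sup>2) = 2 * \<zeta> * \<phi> + 2 * n * (norm (x - \<mu>))\<^sup>2"
      using n by (simp add: field_simps)
    finally show ?thesis using n by (simp add: algebra_simps)
  qed
  then have "(\<Sum>x\<in>N. (1 - 2 * \<zeta>) * \<phi>) \<le> (\<Sum>x\<in>N. D + 2 * n * (norm (x - \<mu>))\<^sup>2)"
    by (intro sum_mono)
  also have "\<dots> = k * D + 2 * n * (\<Sum>x\<in>N. (norm (x - \<mu>))\<^sup>2)"
    by (simp add: sum.distrib sum_distrib_left k_def)
  also have "\<dots> \<le> n * D + 2 * n * D"
    unfolding D_def Delta_def Phi_singleton \<mu>_def[symmetric]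
    using n kn NP by (intro add_mono mult_mono sum_mono2 assms sum_nonneg) auto
  finally have "(1 - 2 * \<zeta>) * (k * \<phi>) \<le> 3 * n * D" by (simp add: k_def algebra_simps)
  \<comment> \<open>\<open>\<zeta> \<le> 1 / 8\<close> gives
    \<open>1 - 2 * \<zeta> \<ge> 3 / 4\<close>; together with the factor 3 above this yields the 4
    of the conclusion.\<close>
  moreover have "3 / 4 * (k * \<phi>) \<le> (1 - 2 * \<zeta>) * (k * \<phi>)"
    using assms kn \<phi> by (intro mult_right_mono) auto
  ultimately have "k * \<phi> \<le> 4 * n * D" by linarith
  then have "\<zeta> * (k * \<phi>) / n \<le> \<zeta> * (4 * n * D) / n"
    using n assms by (intro divide_right_mono mult_left_mono) auto
  moreover have "(\<Sum>x\<in>N. (norm (x - nearest C x))\<^sup>2) \<le> (\<Sum>x\<in>N. \<zeta> * \<phi> / n)"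
    by (intro sum_mono) (simp add: N_def \<phi>_def n_def)
  ultimately show ?thesis using n by (simp add: k_def D_def algebra_simps)
qed

section \<open>Numerical bounds for the rounded parameters\<close>

lemma gc_tau_bounds:
  assumes "0 < \<epsilon>"
  shows "128 / \<epsilon> \<le> real (gc_tau \<epsilon>)" "real (gc_tau \<epsilon>) \<le> 128 / \<epsilon> + 1" "gc_tau \<epsilon> > 0"
proof -
  have "128 / \<epsilon> > 0" using assms by simp
  then show "128 / \<epsilon> \<le> real (gc_tau \<epsilon>)" "real (gc_tau \<epsilon>) \<le> 128 / \<epsilon> + 1" "gc_tau \<epsilon> > 0"
    unfolding gc_tau_def by linarith+
qed

lemma gc_rate_bounds:
  assumes "\<alpha> \<ge> 1" "0 < \<epsilon>" "\<epsilon> \<le> 1 / 2" "t > 0"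
  shows "0 < \<epsilon>\<^sup>2 / (256 * real t * \<alpha>)" "\<epsilon>\<^sup>2 / (256 * real t * \<alpha>) \<le> 1"
proof -
  have "256 * 1 * 1 \<le> 256 * real t * \<alpha>"
    using assms by (intro mult_mono) auto
  moreover have "\<epsilon>\<^sup>2 \<le> 1" using assms by (simp add: abs_square_le_1)
  ultimately show "\<epsilon>\<^sup>2 / (256 * real t * \<alpha>) \<le> 1"
    by (subst pos_divide_le_eq) linarith+
qed (use assms in simp)

text \<open>The choice of \<open>\<eta>\<close> gives
  \<open>q * \<eta> / 2 \<ge> 128 / \<epsilon>\<^sup>2\<close>, at least
  \<open>256 / \<epsilon>\<close> since \<open>\<epsilon> \<le> 1 / 2\<close>. This outweighs
  \<open>2 ^ \<tau> \<le> exp (128 / \<epsilon> + 1)\<close>, where the 1 pays for rounding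
  \<open>\<tau>\<close> up.\<close>

lemma gc_tail_le:
  assumes "\<alpha> \<ge> 1" "0 < \<epsilon>" "\<epsilon> \<le> 1 / 2" "t > 0"
  defines "q \<equiv> \<epsilon>\<^sup>2 / (256 * real t * \<alpha>)"
  shows "2 ^ gc_tau \<epsilon> * (1 - q / 2) ^ gc_eta \<alpha> \<epsilon> t \<le> 1 / 20"
proof -
  note q = gc_rate_bounds[OF assms(1-4), folded q_def]
  have "2 ^ 16 * \<alpha> * real t / \<epsilon> ^ 4 \<le> real (gc_eta \<alpha> \<epsilon> t)"
    unfolding gc_eta_def by linarith
  then have "q / 2 * (2 ^ 16 * \<alpha> * real t / \<epsilon> ^ 4) \<le> q / 2 * real (gc_eta \<alpha> \<epsilon> t)"
    using q by (intro mult_left_mono) auto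
  moreover have "q / 2 * (2 ^ 16 * \<alpha> * real t / \<epsilon> ^ 4) = 128 / \<epsilon>\<^sup>2"
    unfolding q_def using assms by (simp add: field_simps power2_eq_square power4_eq_xxxx)
  moreover have "256 / \<epsilon> \<le> 128 / \<epsilon>\<^sup>2"
    using assms by (simp add: field_simps power2_eq_square)
  ultimately have eta: "256 / \<epsilon> \<le> q / 2 * real (gc_eta \<alpha> \<epsilon> t)" by linarith
  have "(1 - q / 2) ^ gc_eta \<alpha> \<epsilon> t \<le> exp (- (q / 2)) ^ gc_eta \<alpha> \<epsilon> t"
    using q exp_ge_add_one_self[of "- (q / 2)"] by (intro power_mono) auto
  also have "\<dots> = exp (- (q / 2 * real (gc_eta \<alpha> \<epsilon> t)))"
    by (simp add: exp_of_nat_mult[symmetric] algebra_simps)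
  also have "\<dots> \<le> exp (- (256 / \<epsilon>))" using eta by simp
  finally have b: "(1 - q / 2) ^ gc_eta \<alpha> \<epsilon> t \<le> exp (- (256 / \<epsilon>))" .
  have "(2::real) ^ gc_tau \<epsilon> \<le> exp 1 ^ gc_tau \<epsilon>"
    using exp_ge_add_one_self[of 1] by (intro power_mono) auto
  also have "\<dots> = exp (real (gc_tau \<epsilon>))" by (simp add: exp_of_nat_mult[symmetric])
  also have "\<dots> \<le> exp (128 / \<epsilon> + 1)" using gc_tau_bounds[OF assms(2)] by simp
  finally have "2 ^ gc_tau \<epsilon> * (1 - q / 2) ^ gc_eta \<alpha> \<epsilon> t \<le> exp (128 / \<epsilon> + 1) * exp (- (256 / \<epsilon>))"
    using b q by (intro mult_mono) auto
  also have "\<dots> = exp (1 - 128 / \<epsilon>)" by (simp add: exp_add[symmetric] field_simps)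
  \<comment> \<open>A crude weakening: from \<open>exp x \<ge> 1 + x\<close>, the value 19 is just
    enough for \<open>1 / 20\<close>.\<close>
  also have "\<dots> \<le> exp (- 19)" using assms by (simp add: field_simps)
  also have "\<dots> = 1 / exp 19" by (simp add: exp_minus field_simps)
  also have "\<dots> \<le> 1 / 20" using exp_ge_add_one_self[of 19] by (intro divide_left_mono) auto
  finally show ?thesis .
qed

text \<open>\<open>r\<close> is one cluster's share of the allowed error; the \<open>OPT\<close>
  parts of \<open>t\<close> clusters add up to \<open>\<epsilon> / 2 * OPT\<close>.\<close>

lemma prob_good_sample_D2_ge:
  assumes X: "finite X" "P \<subseteq> X" and C: "finite C" "C \<noteq> {}"
    and "\<alpha> \<ge> 1" "0 < \<epsilon>" "\<epsilon> \<le> 1 / 2" "t > 0" "0 \<le> OPT" "Phi C X \<le> \<alpha> * OPT"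
  defines "r \<equiv> \<epsilon> / 2 * Delta P + \<epsilon> / (2 * real t) * OPT"
  shows "measure_pmf.prob (replicate_pmf (gc_eta \<alpha> \<epsilon> t) (D2_pmf C X))
      {ys. good_sample (gc_tau \<epsilon>) C P r (mset ys)} \<ge> 3 / 4"
proof -
  define \<tau> where "\<tau> = gc_tau \<epsilon>"
  define \<phi> where "\<phi> = Phi C P"
  define D where "D = Delta P"
  have fP: "finite P" using X finite_subset by blast
  have \<phi>0: "\<phi> \<ge> 0" and D: "D \<ge> 0"
    unfolding \<phi>_def D_def using C by (simp_all add: Phi_nonneg Delta_nonneg)
  note \<tau> = gc_tau_bounds[OF \<open>0 < \<epsilon>\<close>, folded \<tau>_def]
  have inv\<tau>: "x / real \<tau> \<le> \<epsilon> / 128 * x" if "x \<ge> 0" for x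
  proof -
    have "1 \<le> \<epsilon> / 128 * real \<tau>" using \<tau>(1) \<open>0 < \<epsilon>\<close> by (simp add: field_simps)
    from mult_left_mono[OF this that] show ?thesis using \<tau>(3) by (simp add: field_simps)
  qed
  have r0: "r \<ge> 0" unfolding r_def using assms D D_def by simp
  show ?thesis
  proof (cases "P = {} \<or> \<phi> \<le> \<epsilon> / (4 * real t) * OPT")
    case True
    have "good_sample \<tau> C P r M" for M
    proof (rule good_sample_low_cost[OF fP C \<tau>(3) r0])
      assume "P \<noteq> {}"
      then have le: "\<phi> \<le> \<epsilon> / (4 * real t) * OPT" using True by simp
      have "\<phi> + (2 * \<phi> + 2 * D) / real \<tau> \<le> \<phi> + \<epsilon> / 128 * (2 * \<phi> + 2 * D)"
        using inv\<tau>[of "2 * \<phi> + 2 * D"] \<phi>0 D by simp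
      also have "\<dots> = \<phi> + \<epsilon> / 64 * \<phi> + \<epsilon> / 64 * D" by (simp add: algebra_simps)
      \<comment> \<open>The factor \<open>\<epsilon> / 64\<close> may grow to 1, because the case
        threshold allows exactly \<open>2 * \<phi>\<close> within the \<open>OPT\<close> part of
        \<open>r\<close>.\<close>
      also have "\<dots> \<le> \<phi> + 1 * \<phi> + \<epsilon> / 2 * D"
        using assms \<phi>0 D by (intro add_mono mult_right_mono) auto
      also have "\<dots> \<le> r"
      proof -
        have "\<epsilon> / (2 * real t) * OPT = 2 * (\<epsilon> / (4 * real t) * OPT)" by simp
        then show ?thesis unfolding r_def D_def[symmetric] using le by linarith
      qed
      finally show "Phi C P + (2 * Phi C P + 2 * Delta P) / real \<tau> \<le> r"
        by (simp add: \<phi>_def D_def)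
    qed
    then show ?thesis by (simp add: \<tau>_def)
  next
    case False
    then have ne: "P \<noteq> {}" and \<phi>: "\<epsilon> / (4 * real t) * OPT < \<phi>" by auto
    define n where "n = real (card P)"
    have n: "n > 0" unfolding n_def using fP ne by (simp add: card_gt_0_iff)
    \<comment> \<open>Positive cost excludes the uniform convention in \<open>D2_pmf\<close> and
      makes \<open>OPT\<close> and \<open>r\<close> positive, as the divisions below
      require.\<close>
    have "\<phi> > 0" using \<phi> assms by (smt (verit) divide_nonneg_nonneg mult_nonneg_nonneg of_nat_0_le_iff)
    have \<phi>X: "\<phi> \<le> Phi C X"
      unfolding \<phi>_def Phi_eq_nearest[OF C] using X by (intro sum_mono2) auto
    then have PX: "Phi C X > 0" using \<open>\<phi> > 0\<close> by simp
    then have "\<alpha> * OPT > 0" using assms by linarith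
    then have OPT: "OPT > 0" using assms by (simp add: zero_less_mult_iff)
    define q where "q = \<epsilon>\<^sup>2 / (256 * real t * \<alpha>)"
    define N where "N = {x \<in> P. (norm (x - nearest C x))\<^sup>2 \<le> \<epsilon> / 64 * Phi C P / real (card P)}"
    define e where "e = (\<Sum>x\<in>N. (norm (x - nearest C x))\<^sup>2)"
    have "e \<le> 4 * (\<epsilon> / 64) * D"
      unfolding e_def D_def N_def by (rule snapping_cost_le[OF fP ne C]) (use assms in auto)
    then have e: "e \<le> \<epsilon> / 16 * D" by simp
    have e0: "e \<ge> 0" unfolding e_def by (intro sum_nonneg) auto
    have q: "0 \<le> q" "q \<le> 1"
      unfolding q_def using gc_rate_bounds[OF assms(5-8)] by auto
    have r: "r > 0" unfolding r_def using OPT assms D D_def by (intro add_nonneg_pos) auto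
    note pmf = pmf_D2_pmf[OF X(1) C less_imp_neq[OF PX, symmetric]]
    have pq: "q / real (card P) \<le> pmf (D2_pmf C X) y" if "y \<in> P - N" for y
    proof -
      \<comment> \<open>A point outside \<open>N\<close> costs more than
        \<open>\<epsilon> / 64\<close> of the average, the average exceeds the case threshold
        divided by \<open>n\<close>, and the total cost is at most \<open>\<alpha> * OPT\<close>.
        The quotient is exactly \<open>q / n\<close>.\<close>
      have "\<epsilon> / 64 * (\<epsilon> / (4 * real t) * OPT) / n \<le> \<epsilon> / 64 * \<phi> / n"
        using \<phi> assms n by (intro divide_right_mono mult_left_mono) auto
      also have "\<dots> \<le> (norm (y - nearest C y))\<^sup>2"
        using that by (auto simp: N_def \<phi>_def n_def)
      also have "\<dots> = Phi C {y}" by (simp add: Phi_eq_nearest[OF C])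
      finally have "\<epsilon> / 64 * (\<epsilon> / (4 * real t) * OPT) / n / (\<alpha> * OPT) \<le> Phi C {y} / Phi C X"
        using assms PX C by (intro frac_le) (auto simp: Phi_nonneg)
      moreover have "\<epsilon> / 64 * (\<epsilon> / (4 * real t) * OPT) / n / (\<alpha> * OPT) = q / n"
        unfolding q_def using OPT assms n by (simp add: field_simps power2_eq_square)
      ultimately show ?thesis unfolding pmf n_def using that X by auto
    qed
    have "e + (2 * e + 2 * D) / real \<tau> \<le> e + \<epsilon> / 128 * (2 * e + 2 * D)"
      using inv\<tau>[of "2 * e + 2 * D"] e0 D by simp
    also have "\<dots> \<le> \<epsilon> / 16 * D + \<epsilon> / 128 * (2 * D + 2 * D)"
    proof -
      have "\<epsilon> / 16 * D \<le> 1 * D" using assms D by (intro mult_right_mono) auto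
      then show ?thesis using e assms by (intro add_mono mult_left_mono) auto
    qed
    \<comment> \<open>Here \<open>1 / 16 + 4 / 128 = 3 / 32 < 1 / 10\<close>. As \<open>r\<close> is
      at least \<open>\<epsilon> / 2 * D\<close>, Markov's inequality loses at most
      \<open>1 / 5\<close>; with the tail \<open>1 / 20\<close> the total failure is at most
      \<open>1 / 4\<close>.\<close>
    also have "\<dots> \<le> \<epsilon> / 10 * D" using mult_nonneg_nonneg[of \<epsilon> D] assms D by simp
    also have "\<dots> \<le> r / 5" unfolding r_def D_def[symmetric] using OPT assms by simp
    finally have "(e + (2 * e + 2 * D) / real \<tau>) / r \<le> 1 / 5" using r by (simp add: field_simps)
    moreover have "measure_pmf.prob (replicate_pmf (gc_eta \<alpha> \<epsilon> t) (D2_pmf C X))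
        {ys. good_sample \<tau> C P r (mset ys)}
      \<ge> 1 - (e + (2 * e + 2 * D) / real \<tau>) / r - 2 ^ \<tau> * (1 - q / 2) ^ gc_eta \<alpha> \<epsilon> t"
      unfolding e_def D_def
      by (rule prob_good_sample_ge[OF X(1) _ X(2) ne C q pq \<tau>(3) r])
        (auto simp: set_pmf_eq pmf N_def)
    moreover have "2 ^ \<tau> * (1 - q / 2) ^ gc_eta \<alpha> \<epsilon> t \<le> 1 / 20"
      unfolding q_def \<tau>_def using assms by (intro gc_tail_le) auto
    ultimately show ?thesis unfolding \<tau>_def by linarith
  qed
qed

subsection \<open>All clusters and repetition\<close>

lemma ex_superset_card_eq:
  fixes A :: "'a set"
  assumes "infinite (UNIV :: 'a set)" "finite A" "card A \<le> k"
  shows "\<exists>B. A \<subseteq> B \<and> finite B \<and> card B = k"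
proof -
  have "infinite (- A)" using assms by (simp add: Compl_eq_Diff_UNIV)
  then obtain D where "finite D" "card D = k - card A" "D \<subseteq> - A"
    using infinite_arbitrarily_large by blast
  moreover from this have "card (A \<union> D) = k"
    using assms by (subst card_Un_disjoint) auto
  ultimately show ?thesis using assms by blast
qed

lemma infinite_UNIV_vec: "infinite (UNIV :: (real ^ 'd) set)"
  using not_bounded_UNIV finite_imp_bounded by blast

text \<open>The centroids of the clusters are admissible centers. Some may coincide, so they are
  padded with arbitrary points to exactly \<open>k\<close>, and extra centers never raise the
  cost.\<close>

lemma OPT_star_le:
  assumes "finite X" "k > 0" "disjoint_family_on Xs {..<k}" "(\<Union>i<k. Xs i) = X"
  shows "OPT_star k X \<le> (\<Sum>i<k. Delta (Xs i))"
proof -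
  let ?A = "(\<lambda>i. centroid (Xs i)) ` {..<k}"
  have "card ?A \<le> k" using card_image_le[of "{..<k}" "\<lambda>i. centroid (Xs i)"] by simp
  then obtain B where B: "?A \<subseteq> B" "finite B" "card B = k"
    using ex_superset_card_eq[OF infinite_UNIV_vec, of ?A k] by auto
  have "OPT_star k X \<le> Phi B X"
    unfolding OPT_star_def
  proof (rule cInf_lower)
    show "bdd_below {Phi C X |C. finite C \<and> card C = k}"
      using assms(2) by (auto intro!: bdd_belowI[of _ 0] Phi_nonneg)
  qed (use B in auto)
  also have "\<dots> = (\<Sum>i<k. Phi B (Xs i))"
    unfolding Phi_def assms(4)[symmetric] using assms
    by (intro sum.UNION_disjoint) (auto simp: disjoint_family_on_def)
  also have "\<dots> \<le> (\<Sum>i<k. Delta (Xs i))"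
    unfolding Delta_def using B by (intro sum_mono Phi_le_Phi_singleton) auto
  finally show ?thesis .
qed

text \<open>Containment of the multiset sum expresses disjointness counted with copies. The number
  \<open>s\<close> of clusters served is a parameter so that an induction can add one cluster at a
  time.\<close>

definition good_samples ::
  "nat \<Rightarrow> (real ^ 'd) set \<Rightarrow> nat \<Rightarrow> (nat \<Rightarrow> (real ^ 'd) set) \<Rightarrow> (nat \<Rightarrow> real) \<Rightarrow> (real ^ 'd) list set" where
  "good_samples \<tau> C s P r = {xs. \<exists>Ss. length Ss = s \<and>
     (\<forall>i<s. size (Ss ! i) = \<tau> \<and> Phi {centroid_mset (Ss ! i)} (P i) \<le> Delta (P i) + r i) \<and>
     sum_list Ss \<subseteq># mset xs + repeat_mset (s * \<tau>) (mset_set C)}"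

text \<open>Each further cluster brings its own independent block of \<open>n\<close> samples and
  its own \<open>\<tau>\<close> copies of the centers, so the success probabilities
  multiply.\<close>

lemma prob_good_samples_ge:
  assumes "\<And>i. i < s \<Longrightarrow> measure_pmf.prob (replicate_pmf n p) {ys. good_sample \<tau> C (P i) (r i) (mset ys)} \<ge> b"
    and "0 \<le> b"
  shows "measure_pmf.prob (replicate_pmf (n * s) p) (good_samples \<tau> C s P r) \<ge> b ^ s"
  using assms(1)
proof (induction s)
  case 0
  then show ?case by (simp add: good_samples_def measure_return)
next
  case (Suc s)
  have "b ^ Suc s \<le> measure_pmf.prob (replicate_pmf (n * s) p) (good_samples \<tau> C s P r) *
      measure_pmf.prob (replicate_pmf n p) {ys. good_sample \<tau> C (P s) (r s) (mset ys)}"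
    unfolding power_Suc2 using Suc assms(2) by (intro mult_mono) auto
  also have "\<dots> \<le> measure_pmf.prob (replicate_pmf (n * s + n) p) (good_samples \<tau> C (Suc s) P r)"
  proof (rule prob_replicate_pmf_add_ge)
    fix xs ys
    assume "xs \<in> good_samples \<tau> C s P r" "ys \<in> {ys. good_sample \<tau> C (P s) (r s) (mset ys)}"
    then obtain Ss S where Ss: "length Ss = s"
      "\<forall>i<s. size (Ss ! i) = \<tau> \<and> Phi {centroid_mset (Ss ! i)} (P i) \<le> Delta (P i) + r i"
      "sum_list Ss \<subseteq># mset xs + repeat_mset (s * \<tau>) (mset_set C)"
      and S: "size S = \<tau>" "S \<subseteq># mset ys + repeat_mset \<tau> (mset_set C)"
      "Phi {centroid_mset S} (P s) \<le> Delta (P s) + r s"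
      unfolding good_samples_def good_sample_def by blast
    have "sum_list (Ss @ [S]) \<subseteq>#
        (mset xs + repeat_mset (s * \<tau>) (mset_set C)) + (mset ys + repeat_mset \<tau> (mset_set C))"
      using subset_mset.add_mono[OF Ss(3) S(2)] by simp
    also have "\<dots> = mset (xs @ ys) + repeat_mset (Suc s * \<tau>) (mset_set C)"
      by (rule multiset_eqI) (simp add: algebra_simps)
    finally show "xs @ ys \<in> good_samples \<tau> C (Suc s) P r"
      unfolding good_samples_def using Ss S
      by (auto intro!: exI[of _ "Ss @ [S]"] simp: nth_append less_Suc_eq)
  qed
  finally show ?case by (simp add: add.commute)
qed

text \<open>The union misses \<open>Q\<close> only if every one of the independent rounds
  does.\<close>

lemma prob_Union_replicate_pmf_ge:
  assumes "b \<le> measure_pmf.prob p {L. \<exists>c\<in>L. Q c}"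
  shows "measure_pmf.prob (map_pmf (\<lambda>Ls. \<Union> (set Ls)) (replicate_pmf n p)) {L. \<exists>c\<in>L. Q c}
    \<ge> 1 - (1 - b) ^ n"
proof -
  let ?E = "{L. \<not> (\<exists>c\<in>L. Q c)}"
  have "measure_pmf.prob (map_pmf (\<lambda>Ls. \<Union> (set Ls)) (replicate_pmf n p)) {L. \<exists>c\<in>L. Q c}
      = measure_pmf.prob (replicate_pmf n p) (- {Ls. set Ls \<subseteq> ?E})"
    by (auto intro!: arg_cong[where f="measure _"])
  also have "\<dots> = 1 - measure_pmf.prob p ?E ^ n"
    using measure_pmf.prob_compl[of "{Ls. set Ls \<subseteq> ?E}" "replicate_pmf n p"]
    by (simp add: prob_replicate_pmf_all Compl_eq_Diff_UNIV)
  also have "measure_pmf.prob p ?E = 1 - measure_pmf.prob p {L. \<exists>c\<in>L. Q c}"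
    by (subst measure_pmf.prob_compl[symmetric]) (auto intro!: arg_cong[where f="measure _"])
  finally show ?thesis using assms
    by (auto intro!: power_mono)
qed

lemma repetition_failure_le:
  assumes "t > 0"
  shows "(1 - (3 / 4 :: real) ^ t) ^ (2 ^ t) \<le> 1 / 4"
proof -
  have "(1 - (3 / 4 :: real) ^ t) ^ (2 ^ t) \<le> exp (- ((3 / 4) ^ t)) ^ (2 ^ t)"
    using exp_ge_add_one_self[of "- ((3 / 4 :: real) ^ t)"]
    by (intro power_mono) (auto simp: power_le_one)
  also have "\<dots> = exp (- ((3 / 2) ^ t))"
    by (simp add: exp_of_nat_mult[symmetric] power_mult_distrib[symmetric])
  also have "\<dots> \<le> exp (- (3 / 2))"
    using assms power_increasing[of 1 t "3 / 2 :: real"] by simp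
  \<comment> \<open>Splitting into three factors lets the quadratic Taylor bound suffice:
    \<open>exp (1 / 2) \<ge> 13 / 8\<close>, whose cube exceeds 4.\<close>
  also have "\<dots> = 1 / exp (1 / 2) ^ 3"
    by (simp add: exp_minus field_simps flip: exp_of_nat_mult)
  also have "\<dots> \<le> 1 / (1 + 1 / 2 + (1 / 2)\<^sup>2 / 2) ^ 3"
    using exp_lower_Taylor_quadratic[of "1 / 2"] by (intro frac_le power_mono) (auto simp: power2_eq_square)
  also have "\<dots> \<le> 1 / 4" by (simp add: eval_nat_numeral)
  finally show ?thesis .
qed

text \<open>The identity permutation is enough, as the candidate centers are built in the order of
  the clusters.\<close>

lemma psi_le_sum: "psi cs Ys \<le> (\<Sum>i<length Ys. Phi {cs ! i} (Ys ! i))"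
  unfolding psi_def
  by (rule Min_le) (auto intro!: finite_imageI finite_permutations image_eqI[of _ _ id] permutes_id)

theorem theorem1:
  fixes X C :: "(real ^ 'd) set"
    and Xs :: "nat \<Rightarrow> (real ^ 'd) set"
    and j :: "nat \<Rightarrow> nat"
    and k t :: nat
    and \<alpha> \<epsilon> OPT :: real
  assumes "finite X"
    and "k > 0"
    and "disjoint_family_on Xs {..<k}"
    and "(\<Union>i<k. Xs i) = X"
    and "OPT = (\<Sum>i<k. Delta (Xs i))"
    and "finite C" and "card C = k"
    and "\<alpha> \<ge> 1"
    and "Phi C X \<le> \<alpha> * OPT_star k X"
    and "0 < \<epsilon>" and "\<epsilon> \<le> 1 / 2"
    and "t > 0"
    and "inj_on j {..<t}" and "j ` {..<t} \<subseteq> {..<k}"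
  shows "measure_pmf.prob (t_GoodCenters \<alpha> X C \<epsilon> t)
      {L. \<exists>cs\<in>L. length cs = t \<and>
            psi cs (map (\<lambda>i. Xs (j i)) [0..<t])
              \<le> (1 + \<epsilon> / 2) * (\<Sum>i<t. Delta (Xs (j i))) + \<epsilon> / 2 * OPT \<and>
            (1 + \<epsilon> / 2) * (\<Sum>i<t. Delta (Xs (j i))) + \<epsilon> / 2 * OPT \<le> (1 + \<epsilon>) * OPT}
    \<ge> 3 / 4"
proof -
  define P where "P i = Xs (j i)" for i
  define r where "r i = \<epsilon> / 2 * Delta (P i) + \<epsilon> / (2 * real t) * OPT" for i
  define B where "B = (1 + \<epsilon> / 2) * (\<Sum>i<t. Delta (P i)) + \<epsilon> / 2 * OPT"
  define Q where "Q cs \<longleftrightarrow> length cs = t \<and> psi cs (map P [0..<t]) \<le> B \<and> B \<le> (1 + \<epsilon>) * OPT" for cs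
  define \<tau> where "\<tau> = gc_tau \<epsilon>"
  have C: "C \<noteq> {}" using assms by auto
  have OPT0: "OPT \<ge> 0" unfolding assms(5) by (intro sum_nonneg Delta_nonneg)
  have "\<alpha> * OPT_star k X \<le> \<alpha> * OPT"
    unfolding assms(5) using assms by (intro mult_left_mono OPT_star_le) auto
  then have OPT: "Phi C X \<le> \<alpha> * OPT" using assms by linarith
  \<comment> \<open>The second inequality of the claim involves no randomness: \<open>j\<close> is
    injective, so the selected clusters contribute at most \<open>OPT\<close>.\<close>
  have "(\<Sum>i<t. Delta (P i)) = (\<Sum>i\<in>j ` {..<t}. Delta (Xs i))"
    by (simp add: sum.reindex[OF assms(13)] P_def)
  also have "\<dots> \<le> OPT" unfolding assms(5) using assms(14) by (intro sum_mono2 Delta_nonneg) auto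
  finally have "(1 + \<epsilon> / 2) * (\<Sum>i<t. Delta (P i)) \<le> (1 + \<epsilon> / 2) * OPT"
    using assms by (intro mult_left_mono) auto
  then have B: "B \<le> (1 + \<epsilon>) * OPT" unfolding B_def by (simp add: algebra_simps)
  have "3 / 4 \<le> measure_pmf.prob (replicate_pmf (gc_eta \<alpha> \<epsilon> t) (D2_pmf C X))
      {ys. good_sample \<tau> C (P i) (r i) (mset ys)}" if "i < t" for i
  proof -
    have "P i \<subseteq> X" using that assms by (auto simp: P_def)
    then show ?thesis unfolding r_def \<tau>_def
      using assms C OPT0 OPT by (intro prob_good_sample_D2_ge) auto
  qed
  then have "(3 / 4) ^ t \<le> measure_pmf.prob (replicate_pmf (gc_eta \<alpha> \<epsilon> t * t) (D2_pmf C X))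
      (good_samples \<tau> C t P r)"
    by (intro prob_good_samples_ge) auto
  also have "\<dots> \<le> measure_pmf.prob (good_centers_round \<alpha> X C \<epsilon> t) {L. \<exists>cs\<in>L. Q cs}"
    unfolding good_centers_round_def measure_map_pmf \<tau>_def[symmetric]
  proof (intro measure_pmf.finite_measure_mono subsetI vimageI2 CollectI)
    fix xs assume "xs \<in> good_samples \<tau> C t P r"
    then obtain Ss where Ss: "length Ss = t"
      "\<And>i. i < t \<Longrightarrow> size (Ss ! i) = \<tau> \<and> Phi {centroid_mset (Ss ! i)} (P i) \<le> Delta (P i) + r i"
      "sum_list Ss \<subseteq># mset xs + repeat_mset (t * \<tau>) (mset_set C)"
      unfolding good_samples_def by blast
    have "psi (map centroid_mset Ss) (map P [0..<t]) \<le> (\<Sum>i<t. Phi {centroid_mset (Ss ! i)} (P i))"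
      by (rule order_trans[OF psi_le_sum]) (simp add: Ss(1))
    also have "\<dots> \<le> (\<Sum>i<t. Delta (P i) + r i)" using Ss(2) by (intro sum_mono) auto
    also have "\<dots> = B" unfolding B_def r_def sum.distrib sum_distrib_left[symmetric]
      using \<open>t > 0\<close> by (simp add: algebra_simps)
    finally have "Q (map centroid_mset Ss)" unfolding Q_def using Ss(1) B by simp
    moreover have "map centroid_mset Ss \<in> candidate_centers t \<tau>
        (mset xs + repeat_mset (t * \<tau>) (mset_set C))"
      unfolding candidate_centers_def using Ss by (auto simp: in_set_conv_nth intro!: exI[of _ Ss])
    ultimately show "\<exists>cs\<in>candidate_centers t \<tau>
        (mset xs + repeat_mset (t * \<tau>) (mset_set C)). Q cs" by blast
  qed auto
  \<comment> \<open>One round succeeds with probability at least \<open>(3 / 4) ^ t\<close>; the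
    \<open>2 ^ t\<close> rounds amplify this.\<close>
  finally have "measure_pmf.prob (t_GoodCenters \<alpha> X C \<epsilon> t) {L. \<exists>cs\<in>L. Q cs}
      \<ge> 1 - (1 - (3 / 4) ^ t) ^ (2 ^ t)"
    unfolding t_GoodCenters_def by (rule prob_Union_replicate_pmf_ge)
  then have "measure_pmf.prob (t_GoodCenters \<alpha> X C \<epsilon> t) {L. \<exists>cs\<in>L. Q cs} \<ge> 3 / 4"
    using repetition_failure_le[OF \<open>t > 0\<close>] by linarith
  then show ?thesis unfolding Q_def B_def P_def .
qed

end
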